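(* For all Kripke structures with team $(\mathcal K,T)$, all formulas $\varphi$ of modal team logic $\mathsf{MTL}$ (with the propositional variables of $\varphi$ interpreted in $\mathcal K$), and any first-order variable $x$, it holds that $(\mathcal K,T)\vDash\varphi$ if and only if $(\mathcal A(\mathcal K),T^x)\vDash\mathsf{st}_x(\varphi)$.
   Context: Modal team logic. $\mathsf{ML}$-formulas: $\alpha::=\neg\alpha\mid\alpha\wedge\alpha\mid\alpha\vee\alpha\mid\Box\alpha\mid\Diamond\alpha\mid p$, with $p$ ranging over propositional variables $p_1,p_2,\ldots$. $\mathsf{MTL}$-formulas: $\varphi::={\sim}\varphi\mid\varphi\wedge\varphi\mid\varphi\vee\varphi\mid\Box\varphi\mid\Diamond\varphi\mid\alpha$ with $\alpha\in\mathsf{ML}$. A Kripke structure over a finite set $X$ of propositional variables is $\mathcal K=(W,R,V)$ with $R\subseteq W\times W$ and $V\colon X\to\mathfrak P(W)$. A team in $\mathcal K$ is a set $T\subseteq W$. $Rw=\{v\mid Rwv\}$ and $RT=\bigcup_{w\in T}Rw$. A successor team of $T$ is a set $S\subseteq RT$ such that every $w\in T$ has some $R$-successor in $S$. Semantics: if $\varphi\in\mathsf{ML}$, $(\mathcal K,T)\vDash\varphi$ iff $(\mathcal K,w)\vDash\varphi$ in usual Kripke semantics for all $w\in T$; otherwise $(\mathcal K,T)\vDash{\sim}\psi$ iff $(\mathcal K,T)\nvDash\psi$; $\wedge$ is conjunction; $(\mathcal K,T)\vDash\psi\vee\theta$ iff $T=S\cup U$ for some $S,U\subseteq T$ with $(\mathcal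 K,S)\vDash\psi$, $(\mathcal K,U)\vDash\theta$; $(\mathcal K,T)\vDash\Diamond\psi$ iff $(\mathcal K,S)\vDash\psi$ for some successor team $S$ of $T$; $(\mathcal K,T)\vDash\Box\psi$ iff $(\mathcal K,RT)\vDash\psi$. First-order team logic $\mathsf{FO}(\sim)$ has the formulas $\varphi ::= \alpha \mid {\sim}\varphi \mid \varphi\wedge\varphi \mid \varphi\vee\varphi \mid \exists x\,\varphi \mid \forall x\,\varphi$ with $\alpha$ an ordinary first-order formula. A team $T$ in $\mathcal A$ with domain $X$ is a set of assignments $s\colon X\to\mathrm{dom}\,\mathcal A$. For $f\colon T\to\mathfrak P(\mathrm{dom}\,\mathcal A)\setminus\{\emptyset\}$ let $T^x_f=\{s^x_a\mid s\in T,a\in f(s)\}$, where $s^x_a$ maps $x$ to $a$ and otherwise agrees with $s$; $T^x_A$ is the case $f(s)=A$ constant. Semantics: if $\varphi\in\mathsf{FO}$, $(\mathcal A,T)\vDash\varphi$ iff $(\mathcal A,s)\vDash\varphi$ (Tarski) for all $s\in T$; otherwise ${\sim},\wedge,\vee$ as in $\mathsf{MTL}$ (with $\vee$ splitting $T=S\cup U$); $(\mathcal A,T)\vDash\exists x\,\psi$ iff $(\mathcal A,T^x_f)\vDash\psi$ for some $f\colon T\to\mathfrak P(\mathrm{dom}\,\mathcal A)\setminus\{\emptyset\}$; $(\mathcal A,T)\vDash\forall x\,\psi$ iff $(\mathcal A,T^x_{\mathrm{dom}\,\mathcal A})\vDash\psi$. For $\alpha\in\mathsf{FO}$, $\alpha\hookrightarrow\varphi$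 abbreviates $\neg\alpha\vee(\alpha\wedge\varphi)$. Translation. For two distinct variables $x,y$ and vocabulary $\{R,P_1,P_2,\ldots\}$ ($R$ binary, $P_i$ unary): $\mathsf{st}_x(p_i)=P_ix$; $\mathsf{st}_x(\neg\varphi)=\neg\mathsf{st}_x(\varphi)$; $\mathsf{st}_x({\sim}\varphi)={\sim}\mathsf{st}_x(\varphi)$; $\mathsf{st}_x(\varphi\wedge\psi)=\mathsf{st}_x(\varphi)\wedge\mathsf{st}_x(\psi)$; $\mathsf{st}_x(\varphi\vee\psi)=\mathsf{st}_x(\varphi)\vee\mathsf{st}_x(\psi)$; $\mathsf{st}_x(\Box\varphi)=\forall y\,(Rxy\hookrightarrow\mathsf{st}_y(\varphi))$; $\mathsf{st}_x(\Diamond\varphi)=\exists y\,(Rxy\wedge\mathsf{st}_y(\varphi))$; $\mathsf{st}_y$ is defined symmetrically with $x,y$ exchanged. For $\mathcal K=(W,R,V)$, the structure $\mathcal A(\mathcal K)$ has domain $W$, interprets $R$ by the accessibility relation and $P_i$ by $V(p_i)$. For $w\in W$, $w^x\colon\{x\}\to W$ is the assignment $x\mapsto w$, and $T^x=\{w^x\mid w\in T\}$. *)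

theory Defs
  imports Main
begin

section \<open>Modal team logic\<close>

text \<open>
  The formulas of modal logic and of modal team logic share one raw syntax, because the
  team semantics of a formula depends on whether the formula as a whole is one of modal
  logic. The two grammars are the predicates \<open>is_ML\<close> and \<open>is_MTL\<close>. \<open>MNeg\<close> is the
  classical negation \<open>\<not>\<close>, \<open>MTNeg\<close> the team-wise (Boolean) negation \<open>\<sim>\<close>. The variable
  \<open>p\<^sub>i\<close> is represented by its index.
\<close>

datatype mform =
    MProp nat
  | MNeg mform
  | MTNeg mform
  | MAnd mform mform
  | MOr mform mform
  | MBox mform
  | MDia mform

inductive is_ML :: "mform \<Rightarrow> bool" where
  "is_ML (MProp p)"
| "is_ML \<alpha> \<Longrightarrow> is_ML (MNeg \<alpha>)"
| "is_ML \<alpha> \<Longrightarrow> is_ML \<beta> \<Longrightarrow> is_ML (MAnd \<alpha> \<beta>)"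
| "is_ML \<alpha> \<Longrightarrow> is_ML \<beta> \<Longrightarrow> is_ML (MOr \<alpha> \<beta>)"
| "is_ML \<alpha> \<Longrightarrow> is_ML (MBox \<alpha>)"
| "is_ML \<alpha> \<Longrightarrow> is_ML (MDia \<alpha>)"

inductive is_MTL :: "mform \<Rightarrow> bool" where
  "is_ML \<alpha> \<Longrightarrow> is_MTL \<alpha>"
| "is_MTL \<phi> \<Longrightarrow> is_MTL (MTNeg \<phi>)"
| "is_MTL \<phi> \<Longrightarrow> is_MTL \<psi> \<Longrightarrow> is_MTL (MAnd \<phi> \<psi>)"
| "is_MTL \<phi> \<Longrightarrow> is_MTL \<psi> \<Longrightarrow> is_MTL (MOr \<phi> \<psi>)"
| "is_MTL \<phi> \<Longrightarrow> is_MTL (MBox \<phi>)"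
| "is_MTL \<phi> \<Longrightarrow> is_MTL (MDia \<phi>)"

primrec props :: "mform \<Rightarrow> nat set" where
  "props (MProp p) = {p}"
| "props (MNeg \<phi>) = props \<phi>"
| "props (MTNeg \<phi>) = props \<phi>"
| "props (MAnd \<phi> \<psi>) = props \<phi> \<union> props \<psi>"
| "props (MOr \<phi> \<psi>) = props \<phi> \<union> props \<psi>"
| "props (MBox \<phi>) = props \<phi>"
| "props (MDia \<phi>) = props \<phi>"

text \<open>The valuation \<open>V : X \<rightarrow> Pow W\<close> is a partial map with domain \<open>X\<close>.\<close>

record 'w kripke =
  worlds :: "'w set"
  acc :: "('w \<times> 'w) set"
  val :: "nat \<rightharpoonup> 'w set"

definition kripke_structure :: "'w kripke \<Rightarrow> bool" where
  "kripke_structure K \<longleftrightarrow>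
     acc K \<subseteq> worlds K \<times> worlds K \<and> finite (dom (val K)) \<and> ran (val K) \<subseteq> Pow (worlds K)"

text \<open>Pointwise Kripke semantics; only meant for formulas satisfying \<open>is_ML\<close>.\<close>

primrec msat :: "'w kripke \<Rightarrow> 'w \<Rightarrow> mform \<Rightarrow> bool" where
  "msat K w (MProp p) \<longleftrightarrow> w \<in> the (val K p)"
| "msat K w (MNeg \<phi>) \<longleftrightarrow> \<not> msat K w \<phi>"
| "msat K w (MTNeg \<phi>) \<longleftrightarrow> undefined"
| "msat K w (MAnd \<phi> \<psi>) \<longleftrightarrow> msat K w \<phi> \<and> msat K w \<psi>"
| "msat K w (MOr \<phi> \<psi>) \<longleftrightarrow> msat K w \<phi> \<or> msat K w \<psi>"
| "msat K w (MBox \<phi>) \<longleftrightarrow> (\<forall>v. (w, v) \<in> acc K \<longrightarrow> msat K v \<phi>)"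
| "msat K w (MDia \<phi>) \<longleftrightarrow> (\<exists>v. (w, v) \<in> acc K \<and> msat K v \<phi>)"

definition successor_team :: "'w kripke \<Rightarrow> 'w set \<Rightarrow> 'w set \<Rightarrow> bool" where
  "successor_team K T S \<longleftrightarrow> S \<subseteq> acc K `` T \<and> (\<forall>w\<in>T. \<exists>v\<in>S. (w, v) \<in> acc K)"

text \<open>
  Every \<open>MProp p\<close> satisfies \<open>is_ML\<close>, and so does every \<open>MNeg \<phi>\<close> satisfying \<open>is_MTL\<close>, while
  \<open>MTNeg \<phi>\<close> never does; in the other cases \<open>is_ML\<close> decides which clause applies.
\<close>

primrec mtsat :: "'w kripke \<Rightarrow> 'w set \<Rightarrow> mform \<Rightarrow> bool" where
  "mtsat K T (MProp p) \<longleftrightarrow> (\<forall>w\<in>T. msat K w (MProp p))"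
| "mtsat K T (MNeg \<phi>) \<longleftrightarrow> (\<forall>w\<in>T. msat K w (MNeg \<phi>))"
| "mtsat K T (MTNeg \<phi>) \<longleftrightarrow> \<not> mtsat K T \<phi>"
| "mtsat K T (MAnd \<phi> \<psi>) \<longleftrightarrow>
     (if is_ML (MAnd \<phi> \<psi>) then \<forall>w\<in>T. msat K w (MAnd \<phi> \<psi>)
      else mtsat K T \<phi> \<and> mtsat K T \<psi>)"
| "mtsat K T (MOr \<phi> \<psi>) \<longleftrightarrow>
     (if is_ML (MOr \<phi> \<psi>) then \<forall>w\<in>T. msat K w (MOr \<phi> \<psi>)
      else \<exists>S U. S \<subseteq> T \<and> U \<subseteq> T \<and> T = S \<union> U \<and> mtsat K S \<phi> \<and> mtsat K U \<psi>)"
| "mtsat K T (MBox \<phi>) \<longleftrightarrow>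
     (if is_ML (MBox \<phi>) then \<forall>w\<in>T. msat K w (MBox \<phi>)
      else mtsat K (acc K `` T) \<phi>)"
| "mtsat K T (MDia \<phi>) \<longleftrightarrow>
     (if is_ML (MDia \<phi>) then \<forall>w\<in>T. msat K w (MDia \<phi>)
      else \<exists>S. successor_team K T S \<and> mtsat K S \<phi>)"


section \<open>First-order team logic over the vocabulary \<open>{R, P\<^sub>1, P\<^sub>2, \<dots>}\<close>\<close>

text \<open>First-order variables are natural numbers; the vocabulary has no function symbols,
  so variables are the only terms.\<close>

datatype fform =
    FRel nat nat
  | FPred nat nat  \<comment> \<open>\<open>FPred i x\<close> is \<open>P\<^sub>i x\<close>\<close>
  | FEq nat nat
  | FNeg fform
  | FTNeg fform
  | FAnd fform fform
  | FOr fform fform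
  | FEx nat fform
  | FAll nat fform

inductive is_FO :: "fform \<Rightarrow> bool" where
  "is_FO (FRel x y)"
| "is_FO (FPred i x)"
| "is_FO (FEq x y)"
| "is_FO \<alpha> \<Longrightarrow> is_FO (FNeg \<alpha>)"
| "is_FO \<alpha> \<Longrightarrow> is_FO \<beta> \<Longrightarrow> is_FO (FAnd \<alpha> \<beta>)"
| "is_FO \<alpha> \<Longrightarrow> is_FO \<beta> \<Longrightarrow> is_FO (FOr \<alpha> \<beta>)"
| "is_FO \<alpha> \<Longrightarrow> is_FO (FEx x \<alpha>)"
| "is_FO \<alpha> \<Longrightarrow> is_FO (FAll x \<alpha>)"

inductive is_FOT :: "fform \<Rightarrow> bool" where
  "is_FO \<alpha> \<Longrightarrow> is_FOT \<alpha>"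
| "is_FOT \<phi> \<Longrightarrow> is_FOT (FTNeg \<phi>)"
| "is_FOT \<phi> \<Longrightarrow> is_FOT \<psi> \<Longrightarrow> is_FOT (FAnd \<phi> \<psi>)"
| "is_FOT \<phi> \<Longrightarrow> is_FOT \<psi> \<Longrightarrow> is_FOT (FOr \<phi> \<psi>)"
| "is_FOT \<phi> \<Longrightarrow> is_FOT (FEx x \<phi>)"
| "is_FOT \<phi> \<Longrightarrow> is_FOT (FAll x \<phi>)"

text \<open>As for Kripke structures, the predicate symbols \<open>P\<^sub>i\<close> that are interpreted are those
  in the domain of a partial map.\<close>

record 'a fo_struct =
  univ :: "'a set"
  rel :: "('a \<times> 'a) set"
  pred :: "nat \<rightharpoonup> 'a set"

text \<open>An assignment \<open>s : X \<rightarrow> univ A\<close> is a partial map with domain \<open>X\<close>; \<open>s\<^sup>x\<^sub>a\<close> is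
  \<open>s(x \<mapsto> a)\<close>, whose domain is \<open>X \<union> {x}\<close>.\<close>

type_synonym 'a assignment = "nat \<rightharpoonup> 'a"

definition team :: "'a fo_struct \<Rightarrow> nat set \<Rightarrow> 'a assignment set \<Rightarrow> bool" where
  "team A X T \<longleftrightarrow> (\<forall>s\<in>T. dom s = X \<and> ran s \<subseteq> univ A)"

definition supplement ::
  "'a assignment set \<Rightarrow> nat \<Rightarrow> ('a assignment \<Rightarrow> 'a set) \<Rightarrow> 'a assignment set" where
  "supplement T x f = {s(x \<mapsto> a) | s a. s \<in> T \<and> a \<in> f s}"

text \<open>Tarski semantics; only meant for formulas satisfying \<open>is_FO\<close>.\<close>

primrec fsat :: "'a fo_struct \<Rightarrow> 'a assignment \<Rightarrow> fform \<Rightarrow> bool" where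
  "fsat A s (FRel x y) \<longleftrightarrow> (the (s x), the (s y)) \<in> rel A"
| "fsat A s (FPred i x) \<longleftrightarrow> the (s x) \<in> the (pred A i)"
| "fsat A s (FEq x y) \<longleftrightarrow> the (s x) = the (s y)"
| "fsat A s (FNeg \<phi>) \<longleftrightarrow> \<not> fsat A s \<phi>"
| "fsat A s (FTNeg \<phi>) \<longleftrightarrow> undefined"
| "fsat A s (FAnd \<phi> \<psi>) \<longleftrightarrow> fsat A s \<phi> \<and> fsat A s \<psi>"
| "fsat A s (FOr \<phi> \<psi>) \<longleftrightarrow> fsat A s \<phi> \<or> fsat A s \<psi>"
| "fsat A s (FEx x \<phi>) \<longleftrightarrow> (\<exists>a\<in>univ A. fsat A (s(x \<mapsto> a)) \<phi>)"
| "fsat A s (FAll x \<phi>) \<longleftrightarrow> (\<forall>a\<in>univ A. fsat A (s(x \<mapsto> a)) \<phi>)"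

primrec ftsat :: "'a fo_struct \<Rightarrow> 'a assignment set \<Rightarrow> fform \<Rightarrow> bool" where
  "ftsat A T (FRel x y) \<longleftrightarrow> (\<forall>s\<in>T. fsat A s (FRel x y))"
| "ftsat A T (FPred i x) \<longleftrightarrow> (\<forall>s\<in>T. fsat A s (FPred i x))"
| "ftsat A T (FEq x y) \<longleftrightarrow> (\<forall>s\<in>T. fsat A s (FEq x y))"
| "ftsat A T (FNeg \<phi>) \<longleftrightarrow> (\<forall>s\<in>T. fsat A s (FNeg \<phi>))"
| "ftsat A T (FTNeg \<phi>) \<longleftrightarrow> \<not> ftsat A T \<phi>"
| "ftsat A T (FAnd \<phi> \<psi>) \<longleftrightarrow>
     (if is_FO (FAnd \<phi> \<psi>) then \<forall>s\<in>T. fsat A s (FAnd \<phi> \<psi>)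
      else ftsat A T \<phi> \<and> ftsat A T \<psi>)"
| "ftsat A T (FOr \<phi> \<psi>) \<longleftrightarrow>
     (if is_FO (FOr \<phi> \<psi>) then \<forall>s\<in>T. fsat A s (FOr \<phi> \<psi>)
      else \<exists>S U. S \<subseteq> T \<and> U \<subseteq> T \<and> T = S \<union> U \<and> ftsat A S \<phi> \<and> ftsat A U \<psi>)"
| "ftsat A T (FEx x \<phi>) \<longleftrightarrow>
     (if is_FO (FEx x \<phi>) then \<forall>s\<in>T. fsat A s (FEx x \<phi>)
      else \<exists>f. (\<forall>s\<in>T. f s \<in> Pow (univ A) - {{}}) \<and> ftsat A (supplement T x f) \<phi>)"
| "ftsat A T (FAll x \<phi>) \<longleftrightarrow>
     (if is_FO (FAll x \<phi>) then \<forall>s\<in>T. fsat A s (FAll x \<phi>)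
      else ftsat A (supplement T x (\<lambda>_. univ A)) \<phi>)"

abbreviation hook :: "fform \<Rightarrow> fform \<Rightarrow> fform" where
  "hook \<alpha> \<phi> \<equiv> FOr (FNeg \<alpha>) (FAnd \<alpha> \<phi>)"


section \<open>Standard translation\<close>

text \<open>\<open>st x y\<close> is \<open>st\<^sub>x\<close> for the pair \<open>x, y\<close> of variables, so \<open>st y x\<close> is \<open>st\<^sub>y\<close>.\<close>

primrec st :: "nat \<Rightarrow> nat \<Rightarrow> mform \<Rightarrow> fform" where
  "st x y (MProp p) = FPred p x"
| "st x y (MNeg \<phi>) = FNeg (st x y \<phi>)"
| "st x y (MTNeg \<phi>) = FTNeg (st x y \<phi>)"
| "st x y (MAnd \<phi> \<psi>) = FAnd (st x y \<phi>) (st x y \<psi>)"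
| "st x y (MOr \<phi> \<psi>) = FOr (st x y \<phi>) (st x y \<psi>)"
| "st x y (MBox \<phi>) = FAll y (hook (FRel x y) (st y x \<phi>))"
| "st x y (MDia \<phi>) = FEx y (FAnd (FRel x y) (st y x \<phi>))"

definition struct_of :: "'w kripke \<Rightarrow> 'w fo_struct" where
  "struct_of K = \<lparr>univ = worlds K, rel = acc K, pred = val K\<rparr>"

definition team_of :: "nat \<Rightarrow> 'w set \<Rightarrow> 'w assignment set" where
  "team_of x T = {[x \<mapsto> w] | w. w \<in> T}"

lemma FO_st: "is_ML \<phi> \<Longrightarrow> is_FO (st x y \<phi>)"
  by (induction \<phi> arbitrary: x y rule: is_ML.induct) (simp_all add: is_FO.intros)

lemma FOT_st: "is_MTL \<phi> \<Longrightarrow> is_FOT (st x y \<phi>)"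
  by (induction \<phi> arbitrary: x y rule: is_MTL.induct) (simp_all add: is_FO.intros is_FOT.intros FO_st)

lemma team_team_of: "T \<subseteq> worlds K \<Longrightarrow> team (struct_of K) {x} (team_of x T)"
  by (auto simp: team_def team_of_def struct_of_def split: if_splits)

end

theory Submission
  imports Defs
begin

text \<open>
  A team of assignments matters for \<open>st\<^sub>x(\<phi>)\<close> only through its set of values at \<open>x\<close>, whatever
  other variables the assignments are defined on. This strengthening is proved by induction on
  \<open>\<phi>\<close>. For \<open>\<Diamond>\<close>, a successor team \<open>S\<close> corresponds to the supplementing function
  \<open>s \<mapsto> R(s(x)) \<inter> S\<close>; for \<open>\<box>\<close>, the split required by \<open>\<hookrightarrow>\<close> is unique, its second half being the
  part of the team on which \<open>Rxy\<close> holds.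
\<close>

definition team_values :: "nat \<Rightarrow> 'a assignment set \<Rightarrow> 'a set" where
  "team_values x S = (\<lambda>s. the (s x)) ` S"

lemma team_values_team_of [simp]: "team_values x (team_of x T) = T"
  by (force simp: team_values_def team_of_def image_iff)

lemma rel_struct_of [simp]: "rel (struct_of K) = acc K"
  and univ_struct_of [simp]: "univ (struct_of K) = worlds K"
  and pred_struct_of [simp]: "pred (struct_of K) = val K"
  by (simp_all add: struct_of_def)

inductive_simps is_FO_simps [simp]:
  "is_FO (FRel x y)" "is_FO (FPred i x)" "is_FO (FNeg \<alpha>)" "is_FO (FTNeg \<alpha>)"
  "is_FO (FAnd \<alpha> \<beta>)" "is_FO (FOr \<alpha> \<beta>)" "is_FO (FEx x \<alpha>)" "is_FO (FAll x \<alpha>)"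

inductive_simps is_ML_simps [simp]:
  "is_ML (MProp p)" "is_ML (MNeg \<alpha>)" "is_ML (MTNeg \<alpha>)"
  "is_ML (MAnd \<alpha> \<beta>)" "is_ML (MOr \<alpha> \<beta>)" "is_ML (MBox \<alpha>)" "is_ML (MDia \<alpha>)"

text \<open>Both semantics branch on membership in the pointwise fragment. The direction from right
  to left is \<open>FO_st\<close>; the other ensures that, outside ML, the translation is evaluated
  by the team clauses as well.\<close>

lemma is_FO_st_iff [simp]: "is_FO (st x y \<phi>) \<longleftrightarrow> is_ML \<phi>"
  by (induction \<phi> arbitrary: x y) auto

lemma mtsat_ML: "is_ML \<phi> \<Longrightarrow> mtsat K T \<phi> \<longleftrightarrow> (\<forall>w\<in>T. msat K w \<phi>)"
  by (cases \<phi>) auto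

lemma ftsat_FO: "is_FO \<phi> \<Longrightarrow> ftsat A S \<phi> \<longleftrightarrow> (\<forall>s\<in>S. fsat A s \<phi>)"
  by (cases \<phi>) auto

text \<open>At most \<open>x\<close> is free in \<open>st x y \<phi>\<close>, so \<open>s\<close>
  may carry a stale value at \<open>y\<close>, which every quantifier over \<open>y\<close>
  overwrites. Such an update keeps the world stored at \<open>x\<close>, and as \<open>acc K\<close>
  stays inside \<open>worlds K\<close>, quantifying over the universe reaches all
  successors.\<close>

lemma fsat_st_iff:
  assumes "acc K \<subseteq> worlds K \<times> worlds K" and "is_ML \<phi>" and "x \<noteq> y"
  shows "fsat (struct_of K) s (st x y \<phi>) \<longleftrightarrow> msat K (the (s x)) \<phi>"
  using assms(2,3)
proof (induction \<phi> arbitrary: s x y rule: mform.induct)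
  case (MBox \<phi>)
  then have "fsat (struct_of K) (s(y \<mapsto> v)) (st y x \<phi>) \<longleftrightarrow> msat K v \<phi>" for v
    by simp
  then show ?case using MBox.prems assms(1) by auto
next
  case (MDia \<phi>)
  then have "fsat (struct_of K) (s(y \<mapsto> v)) (st y x \<phi>) \<longleftrightarrow> msat K v \<phi>" for v
    by simp
  then show ?case using MDia.prems assms(1) by auto
qed auto

text \<open>A split of the team maps to a split of its values by taking images. Conversely, a split
  of the values lifts to full preimages, which cover the team and have exactly the prescribed
  values.\<close>

lemma team_values_eq_Un_iff:
  "(\<exists>S1 S2. S1 \<subseteq> S \<and> S2 \<subseteq> S \<and> S = S1 \<union> S2 \<and> P (team_values x S1) \<and> Q (team_values x S2)) \<longleftrightarrow>
   (\<exists>T1 T2. T1 \<subseteq> team_values x S \<and> T2 \<subseteq> team_values x S \<and> team_values x S = T1 \<union> T2 \<and> P T1 \<and> Q T2)"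
  (is "?L \<longleftrightarrow> ?R")
proof
  assume ?L
  then obtain S1 S2 where "S = S1 \<union> S2" "P (team_values x S1)" "Q (team_values x S2)"
    by blast
  then show ?R
    by (intro exI[of _ "team_values x S1"] exI[of _ "team_values x S2"])
      (auto simp: team_values_def)
next
  assume ?R
  then obtain T1 T2 where T: "team_values x S = T1 \<union> T2" "P T1" "Q T2"
    by blast
  define S' where "S' U = {s \<in> S. the (s x) \<in> U}" for U
  have "team_values x (S' U) = U" if "U \<subseteq> team_values x S" for U
    using that by (auto simp: team_values_def S'_def)
  then have "team_values x (S' T1) = T1" "team_values x (S' T2) = T2"
    using T(1) by simp_all
  moreover have "the (s x) \<in> T1 \<union> T2" if "s \<in> S" for s
    using that by (simp add: team_values_def flip: T(1))
  then have "S = S' T1 \<union> S' T2"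
    by (auto simp: S'_def)
  moreover have "S' T1 \<subseteq> S" "S' T2 \<subseteq> S"
    by (auto simp: S'_def)
  ultimately show ?L
    using T(2,3) by metis
qed

lemma ftsat_hook_iff:
  assumes "is_FO \<alpha>" and "\<not> is_FO \<phi>"
  shows "ftsat A S (hook \<alpha> \<phi>) \<longleftrightarrow> ftsat A {s \<in> S. fsat A s \<alpha>} \<phi>"
proof
  assume "ftsat A S (hook \<alpha> \<phi>)"
  then obtain S1 S2 where S: "S = S1 \<union> S2" "\<forall>s\<in>S1. \<not> fsat A s \<alpha>" "\<forall>s\<in>S2. fsat A s \<alpha>"
    and "ftsat A S2 \<phi>"
    using assms by (auto simp: ftsat_FO)
  moreover from S have "{s \<in> S. fsat A s \<alpha>} = S2" by blast
  ultimately show "ftsat A {s \<in> S. fsat A s \<alpha>} \<phi>" by simp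
next
  assume *: "ftsat A {s \<in> S. fsat A s \<alpha>} \<phi>"
  let ?U = "{s \<in> S. fsat A s \<alpha>}" and ?V = "{s \<in> S. \<not> fsat A s \<alpha>}"
  have "?V \<subseteq> S" "?U \<subseteq> S" "S = ?V \<union> ?U" by auto
  moreover have "ftsat A ?V (FNeg \<alpha>)" by simp
  moreover have "ftsat A ?U (FAnd \<alpha> \<phi>)" using assms * by (simp add: ftsat_FO)
  moreover have "\<not> is_FO (hook \<alpha> \<phi>)" using assms by simp
  \<comment> \<open>Only the outer clause is unfolded, so that the facts about \<open>?V\<close> and
    \<open>?U\<close> match its two disjuncts as they stand.\<close>
  ultimately show "ftsat A S (hook \<alpha> \<phi>)"
    unfolding ftsat.simps(7) if_not_P[OF \<open>\<not> is_FO (hook \<alpha> \<phi>)\<close>] by blast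
qed

lemma team_values_supplement_acc:
  assumes "acc K \<subseteq> worlds K \<times> worlds K" and "x \<noteq> y"
  shows "team_values y {s \<in> supplement S y (\<lambda>_. worlds K). (the (s x), the (s y)) \<in> acc K} =
    acc K `` team_values x S"
proof (intro set_eqI iffI)
  fix v
  assume "v \<in> acc K `` team_values x S"
  then obtain s where "s \<in> S" "(the (s x), v) \<in> acc K"
    by (auto simp: team_values_def)
  moreover then have "v \<in> worlds K" using assms(1) by blast
  ultimately have "s(y \<mapsto> v) \<in>
      {s \<in> supplement S y (\<lambda>_. worlds K). (the (s x), the (s y)) \<in> acc K}"
    using assms(2) by (auto simp: supplement_def)
  then show "v \<in> team_values y \<dots>"
    unfolding team_values_def by (rule rev_image_eqI) simp
qed (use assms(2) in \<open>auto simp: team_values_def supplement_def\<close>)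

text \<open>The two conditions on a successor team split up: nonempty \<open>f s\<close> gives every
  world a successor in \<open>U\<close>, while \<open>Rxy\<close> on the supplemented team gives
  \<open>U\<close> inside the image of the values.\<close>

lemma successor_team_iff_supplement:
  assumes "acc K \<subseteq> worlds K \<times> worlds K" and "x \<noteq> y"
  shows "successor_team K (team_values x S) U \<longleftrightarrow>
    (\<exists>f. (\<forall>s\<in>S. f s \<in> Pow (worlds K) - {{}}) \<and>
      (\<forall>s\<in>supplement S y f. (the (s x), the (s y)) \<in> acc K) \<and>
      U = team_values y (supplement S y f))"
  (is "?L \<longleftrightarrow> ?R")
proof
  assume U: ?L
  define f where "f s = acc K `` {the (s x)} \<inter> U" for s :: "'a assignment"
  have "team_values y (supplement S y f) = (\<Union>s\<in>S. f s)"
    by (force simp: team_values_def supplement_def image_iff)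
  \<comment> \<open>Every element of \<open>U\<close> succeeds some value of the team, so the sets
    \<open>f s\<close> exhaust \<open>U\<close>.\<close>
  also have "\<dots> = U"
    using U by (auto simp: f_def successor_team_def team_values_def)
  finally have "U = team_values y (supplement S y f)" ..
  moreover have "\<forall>s\<in>S. f s \<in> Pow (worlds K) - {{}}"
    using U assms(1) by (fastforce simp: f_def successor_team_def team_values_def)
  moreover have "\<forall>s\<in>supplement S y f. (the (s x), the (s y)) \<in> acc K"
    using assms(2) by (auto simp: supplement_def f_def)
  ultimately show ?R by blast
next
  assume ?R
  then obtain f where f: "\<And>s. s \<in> S \<Longrightarrow> f s \<noteq> {}"
    "\<forall>s\<in>supplement S y f. (the (s x), the (s y)) \<in> acc K"
    and U: "U = team_values y (supplement S y f)"
    by blast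
  have acc: "(the (s x), v) \<in> acc K" if "s \<in> S" "v \<in> f s" for s v
    using f(2) that assms(2) by (force simp: supplement_def)
  have "U = (\<Union>s\<in>S. f s)"
    unfolding U by (force simp: team_values_def supplement_def image_iff)
  then show ?L
    using acc f(1) by (fastforce simp: successor_team_def team_values_def)
qed

lemma ftsat_st_iff:
  assumes "acc K \<subseteq> worlds K \<times> worlds K" and "is_MTL \<phi>" and "x \<noteq> y"
  shows "ftsat (struct_of K) S (st x y \<phi>) \<longleftrightarrow> mtsat K (team_values x S) \<phi>"
proof -
  have flat: "ftsat (struct_of K) S (st x y \<phi>) \<longleftrightarrow> mtsat K (team_values x S) \<phi>"
    if "is_ML \<phi>" "x \<noteq> y" for \<phi> x y S
    using that assms(1) by (simp add: ftsat_FO mtsat_ML fsat_st_iff team_values_def)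
  from assms(2,3) show ?thesis
  proof (induction \<phi> arbitrary: x y S rule: is_MTL.induct)
    case (1 \<alpha>)
    then show ?case by (rule flat)
  next
    case (2 \<phi>)
    then show ?case by simp
  next
    case (3 \<phi> \<psi>)
    \<comment> \<open>The rules of \<open>is_MTL\<close> overlap: this conjunction may still lie in
      ML, where the pointwise clause applies. The same case split recurs below.\<close>
    show ?case
    proof (cases "is_ML (MAnd \<phi> \<psi>)")
      case True
      then show ?thesis using \<open>x \<noteq> y\<close> by (rule flat)
    next
      case False
      then show ?thesis using 3 by auto
    qed
  next
    case (4 \<phi> \<psi>)
    show ?case
    proof (cases "is_ML (MOr \<phi> \<psi>)")
      case True
      then show ?thesis using \<open>x \<noteq> y\<close> by (rule flat)
    next
      case False
      then have "\<not> is_FO (st x y (MOr \<phi> \<psi>))" by simp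
      with False show ?thesis
        by (simp only: st.simps ftsat.simps mtsat.simps if_False "4.IH" \<open>x \<noteq> y\<close>
            not_False_eq_True
            team_values_eq_Un_iff[where P = "\<lambda>T. mtsat K T \<phi>" and Q = "\<lambda>T. mtsat K T \<psi>"])
    qed
  next
    case (5 \<phi>)
    show ?case
    proof (cases "is_ML (MBox \<phi>)")
      case True
      then show ?thesis using \<open>x \<noteq> y\<close> by (rule flat)
    next
      case False
      then have "ftsat (struct_of K) S (st x y (MBox \<phi>)) \<longleftrightarrow>
        ftsat (struct_of K) (supplement S y (\<lambda>_. worlds K)) (hook (FRel x y) (st y x \<phi>))"
        by simp
      \<comment> \<open>The hook cuts the supplemented team down to \<open>Rxy\<close>; the
        induction hypothesis, with \<open>x\<close> and \<open>y\<close> exchanged, then sees only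
        the values at \<open>y\<close>, which are the successors.\<close>
      also have "\<dots> \<longleftrightarrow> mtsat K (acc K `` team_values x S) \<phi>"
        using False 5 by (simp add: ftsat_hook_iff team_values_supplement_acc[OF assms(1)]
            del: ftsat.simps)
      finally show ?thesis using False by simp
    qed
  next
    case (6 \<phi>)
    show ?case
    proof (cases "is_ML (MDia \<phi>)")
      case True
      then show ?thesis using \<open>x \<noteq> y\<close> by (rule flat)
    next
      case False
      \<comment> \<open>Here the conjunction in the translation is evaluated conjunct by conjunct on
        the supplemented team, and its first conjunct \<open>Rxy\<close> holds pointwise.\<close>
      then show ?thesis
        using 6 by (auto simp: successor_team_iff_supplement[OF assms(1) \<open>x \<noteq> y\<close>])
    qed
  qed
qed

theorem theorem5p2:
  fixes K :: "'w kripke" and T :: "'w set" and \<phi> :: mform and x y :: nat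
  assumes "kripke_structure K"
    and "T \<subseteq> worlds K"
    and "is_MTL \<phi>"
    and "props \<phi> \<subseteq> dom (val K)"
    and "x \<noteq> y"
  shows "mtsat K T \<phi> \<longleftrightarrow> ftsat (struct_of K) (team_of x T) (st x y \<phi>)"
  using assms(1,3,5) by (simp add: kripke_structure_def ftsat_st_iff)

end
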